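(* Let $G$ be an infinitesimally finitely generated topological group and let $H$ be a quasi non-archimedean topological group. Then any continuous homomorphism $\varphi: G\to H$ is trivial.
   Context: Topological groups are assumed Hausdorff. For a topological group $G$, the infinitesimal rank $t_I(G)$ is the minimum $n\in\mathbb{N}\cup\{+\infty\}$ such that every neighborhood of the identity in $G$ contains $n$ elements $g_1,\dots,g_n$ which generate a dense subgroup of $G$; $G$ is infinitesimally finitely generated if $t_I(G)<+\infty$. A topological group $H$ is quasi non-archimedean if for every $n\in\mathbb{N}$ and every neighborhood of the identity $V\subseteq H$, there exists a neighborhood of the identity $U\subseteq V$ such that for all $g_1,\dots,g_n\in U$, the group generated by $g_1,\dots,g_n$ is contained in $V$. *)

theory Defs
  imports "HOL-Analysis.Analysis" "HOL-Algebra.Generated_Groups"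
begin

text \<open>
  Topological groups are Hausdorff by convention. The topology is a separate parameter
  whose underlying set is the carrier of the group.
\<close>

locale topological_group = group G
  for G (structure) and T :: "'a topology" +
  assumes topspace_eq_carrier: "topspace T = carrier G"
    and Hausdorff: "Hausdorff_space T"
    and continuous_mult: "continuous_map (prod_topology T T) T (\<lambda>(x, y). x \<otimes> y)"
    and continuous_inv: "continuous_map T T (\<lambda>x. inv x)"

text \<open>Neighbourhoods need not be open.\<close>

definition identity_nbhd :: "('a, 'c) monoid_scheme \<Rightarrow> 'a topology \<Rightarrow> 'a set \<Rightarrow> bool" where
  "identity_nbhd G T V \<longleftrightarrow>
     V \<subseteq> topspace T \<and> (\<exists>W. openin T W \<and> \<one>\<^bsub>G\<^esub> \<in> W \<and> W \<subseteq> V)"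

text \<open>
  Families of \<open>n\<close> elements are functions restricted to \<open>{1..n}\<close>; repetitions are allowed,
  and for \<open>n = 0\<close> the generated subgroup is trivial. In the following definition the infimum
  is a minimum, and it is \<open>\<infinity>\<close> if no natural number has the required property.
\<close>

definition infinitesimal_rank :: "('a, 'c) monoid_scheme \<Rightarrow> 'a topology \<Rightarrow> enat" where
  "infinitesimal_rank G T =
     Inf {enat n | n. \<forall>V. identity_nbhd G T V \<longrightarrow>
            (\<exists>g :: nat \<Rightarrow> 'a. g ` {1..n} \<subseteq> V \<and>
               T closure_of (generate G (g ` {1..n})) = topspace T)}"

definition infinitesimally_finitely_generated ::
    "('a, 'c) monoid_scheme \<Rightarrow> 'a topology \<Rightarrow> bool" where
  "infinitesimally_finitely_generated G T \<longleftrightarrow> infinitesimal_rank G T < \<infinity>"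

definition quasi_non_archimedean :: "('a, 'c) monoid_scheme \<Rightarrow> 'a topology \<Rightarrow> bool" where
  "quasi_non_archimedean H T \<longleftrightarrow>
     (\<forall>n :: nat. \<forall>V. identity_nbhd H T V \<longrightarrow>
        (\<exists>U. identity_nbhd H T U \<and> U \<subseteq> V \<and>
           (\<forall>g :: nat \<Rightarrow> 'a. g ` {1..n} \<subseteq> U \<longrightarrow> generate H (g ` {1..n}) \<subseteq> V)))"

end

theory Submission
  imports Defs
begin

text \<open>
  The \<open>n\<close> topological generators of \<open>G\<close> can be chosen in any neighbourhood of the identity,
  hence so close to it that their images in \<open>H\<close> fall into whatever small neighbourhood the
  quasi non-archimedean property asks for. The image of the dense subgroup they generate is
  then trapped in a prescribed neighbourhood \<open>A\<close> of the identity of \<open>H\<close>. If \<open>\<phi> x\<close> were not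
  the identity, the Hausdorff property would give such an \<open>A\<close> disjoint from a neighbourhood
  \<open>B\<close> of \<open>\<phi> x\<close>; but \<open>\<phi>\<close> maps some point of the dense subgroup into \<open>B\<close>. The argument works
  because the number \<open>n\<close> of generators is fixed before the neighbourhood is chosen.
\<close>

text \<open>
  The infimum of the empty set is \<open>\<infinity>\<close>, so a finite rank yields a number \<open>n\<close> of generators
  that is uniform in the neighbourhood \<open>V\<close>.
\<close>

lemma infinitesimally_finitely_generated_bound:
  fixes G :: "('a, 'c) monoid_scheme"
  assumes "infinitesimally_finitely_generated G T"
  shows "\<exists>n. \<forall>V. identity_nbhd G T V \<longrightarrow>
    (\<exists>g :: nat \<Rightarrow> 'a. g ` {1..n} \<subseteq> V \<and> T closure_of (generate G (g ` {1..n})) = topspace T)"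
proof (rule ccontr)
  assume "\<not> ?thesis"
  then have "infinitesimal_rank G T = Inf {}"
    unfolding infinitesimal_rank_def by (intro arg_cong[where f = Inf]) blast
  then show False
    using assms unfolding infinitesimally_finitely_generated_def by (simp add: top_enat_def)
qed

lemma identity_nbhd_preimage:
  assumes "group_hom G H \<phi>" "topspace TG = carrier G" "continuous_map TG TH \<phi>"
    and "identity_nbhd H TH U"
  shows "identity_nbhd G TG {x \<in> topspace TG. \<phi> x \<in> U}"
proof -
  interpret group_hom G H \<phi> by fact
  obtain W where W: "openin TH W" "\<one>\<^bsub>H\<^esub> \<in> W" "W \<subseteq> U"
    using assms(4) unfolding identity_nbhd_def by blast
  have "openin TG {x \<in> topspace TG. \<phi> x \<in> W}"
    using assms(3) W(1) by (rule openin_continuous_map_preimage)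
  then show ?thesis
    unfolding identity_nbhd_def using W assms(2)
    by (intro conjI exI[of _ "{x \<in> topspace TG. \<phi> x \<in> W}"]) auto
qed

theorem proposition5p5:
  fixes G :: "('a, 'c) monoid_scheme" and TG :: "'a topology"
    and H :: "('b, 'd) monoid_scheme" and TH :: "'b topology"
    and \<phi> :: "'a \<Rightarrow> 'b"
  assumes "topological_group G TG"
    and "infinitesimally_finitely_generated G TG"
    and "topological_group H TH"
    and "quasi_non_archimedean H TH"
    and "\<phi> \<in> hom G H"
    and "continuous_map TG TH \<phi>"
  shows "\<forall>x\<in>carrier G. \<phi> x = \<one>\<^bsub>H\<^esub>"
proof (intro ballI, rule ccontr)
  fix x assume x: "x \<in> carrier G" and neq: "\<phi> x \<noteq> \<one>\<^bsub>H\<^esub>"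
  interpret G: topological_group G TG by fact
  interpret H: topological_group H TH by fact
  interpret group_hom G H \<phi>
    using assms(5) by unfold_locales
  obtain n where n: "\<forall>V. identity_nbhd G TG V \<longrightarrow>
      (\<exists>g :: nat \<Rightarrow> 'a. g ` {1..n} \<subseteq> V \<and> TG closure_of (generate G (g ` {1..n})) = topspace TG)"
    using infinitesimally_finitely_generated_bound[OF assms(2)] by (elim exE)
  obtain A B where AB: "openin TH A" "openin TH B" "\<one>\<^bsub>H\<^esub> \<in> A" "\<phi> x \<in> B" "disjnt A B"
    using H.Hausdorff neq x H.topspace_eq_carrier
    unfolding Hausdorff_space_def by (metis H.one_closed hom_closed)
  have "identity_nbhd H TH A"
    unfolding identity_nbhd_def using AB openin_subset by blast
  then obtain U where U: "identity_nbhd H TH U"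
      "\<And>h :: nat \<Rightarrow> 'b. h ` {1..n} \<subseteq> U \<Longrightarrow> generate H (h ` {1..n}) \<subseteq> A"
    using assms(4) unfolding quasi_non_archimedean_def by blast
  obtain g :: "nat \<Rightarrow> 'a" where g: "g ` {1..n} \<subseteq> {x \<in> topspace TG. \<phi> x \<in> U}"
      "TG closure_of (generate G (g ` {1..n})) = topspace TG"
    using n[rule_format, OF identity_nbhd_preimage[OF group_hom_axioms G.topspace_eq_carrier assms(6) U(1)]]
    by blast
  have "(\<phi> \<circ> g) ` {1..n} \<subseteq> U"
    using g(1) by auto
  then have "generate H (\<phi> ` g ` {1..n}) \<subseteq> A"
    using U(2) by (metis image_comp)
  moreover have "g ` {1..n} \<subseteq> carrier G"
    using g(1) G.topspace_eq_carrier by auto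
  ultimately have trapped: "\<phi> ` generate G (g ` {1..n}) \<subseteq> A"
    using generate_img by simp
  have "x \<in> TG closure_of (generate G (g ` {1..n}))"
    using g(2) x G.topspace_eq_carrier by simp
  moreover have "x \<in> {y \<in> topspace TG. \<phi> y \<in> B}"
    using AB(4) x G.topspace_eq_carrier by simp
  moreover have "openin TG {y \<in> topspace TG. \<phi> y \<in> B}"
    using assms(6) AB(2) by (rule openin_continuous_map_preimage)
  ultimately have "\<exists>y. y \<in> generate G (g ` {1..n}) \<and> y \<in> {y \<in> topspace TG. \<phi> y \<in> B}"
    unfolding in_closure_of by metis
  then show False
    using trapped AB(5) unfolding disjnt_def by blast
qed

end
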